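(* Let $Y$ be a Banach space, let $\Omega:\mathcal{M}(Y)\to\mathbb{R}_+$ be a quasimeasure of noncompactness, let $\kappa:\mathcal{M}(Y)\to\mathbb{R}_+$ be the measure of nonconvexity, and let $C\subset Y$ be a nonempty, bounded and closed subset. Let $\Phi:C\to C$ be a continuous function such that: (D) for all $A\subset C$, $\Omega(\Phi(A))\le\varphi_D(\Omega(A))$, where $\varphi_D:\mathbb{R}_+\to\mathbb{R}_+$ is a nondecreasing function such that $\lim_{n\to\infty}\varphi_D^{(n)}(t)=0$ for every $t\ge0$; (E) for all $A\subset C$, $\kappa(\Phi(A))\le\varphi_E(\kappa(A))$, where $\varphi_E:\mathbb{R}_+\to\mathbb{R}_+$ is a nondecreasing function such that $\lim_{n\to\infty}\varphi_E^{(n)}(t)=0$ for every $t\ge0$. Then $\Phi$ has at least one fixed point in $C$.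
   Context: $\mathbb{R}_+=[0,\infty)$; $\varphi^{(n)}$ denotes the $n$-fold composition of $\varphi$ with itself. Banach spaces are over $\mathbb{R}$ or $\mathbb{C}$. $\mathcal{M}(Y)$ is the family of bounded subsets of $Y$. Quasimeasure of noncompactness: a function $\Omega:\mathcal{M}(Y)\to\mathbb{R}_+$ such that (QMN1) for every $A\in\mathcal{M}(Y)$, $\Omega(A)=0$ if and only if $A$ is relatively compact; (QMN2) if $A,B\in\mathcal{M}(Y)$ and $A\subset B$ then $\Omega(A)\le\Omega(B)$; (QMN3) $\Omega(\overline{A})=\Omega(A)$ for every $A\in\mathcal{M}(Y)$; (QMN4) $\Omega(\lambda A)=|\lambda|\,\Omega(A)$ for every $A\in\mathcal{M}(Y)$ and every scalar $\lambda$; (QMN5) for every finite $A$ and every $B\in\mathcal{M}(Y)$ with $A\cap B=\emptyset$, $\Omega(A\cup B)=\Omega(B)$. Measure of nonconvexity: $\kappa(A):=d_H(A,\mathrm{conv}(A))$ for $A\in\mathcal{M}(Y)$, where $d_H$ is the Hausdorff distance and $\mathrm{conv}(A)$ is the convex hull (with $\kappa(\emptyset)=0$). *)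

theory Defs
  imports "HOL-Analysis.Analysis"
begin

text \<open>
  The class \<open>banach\<close> only knows the real scalar action. The locale below covers the real and the
  complex case at once: by the Gelfand--Mazur theorem, every field of class
  \<open>real_normed_field\<close> is isomorphic to the reals or to the complex numbers. Real Banach spaces
  are the instance \<open>scale = scaleR\<close>; a complex Banach space is a type of class \<open>banach\<close> with a
  complex \<open>scale\<close> that extends its real scalar action.
\<close>

locale banach_scaling = vector_space scale
  for scale :: "'k::real_normed_field \<Rightarrow> 'a::banach \<Rightarrow> 'a" +
  assumes scale_of_real: "scale (of_real r) x = r *\<^sub>R x"
    and norm_scale: "norm (scale c x) = norm c * norm x"

lemma banach_scaling_scaleR: "banach_scaling (scaleR :: real \<Rightarrow> 'a::banach \<Rightarrow> 'a)"
  by unfold_locales (auto simp: algebra_simps)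

lemma banach_scaling_complex: "banach_scaling ((*) :: complex \<Rightarrow> complex \<Rightarrow> complex)"
  by unfold_locales (auto simp: algebra_simps norm_mult scaleR_conv_of_real)

text \<open>Only the values of \<open>\<Omega>\<close> on bounded sets matter.\<close>

locale quasimeasure_of_noncompactness = banach_scaling scale
  for scale :: "'k::real_normed_field \<Rightarrow> 'a::banach \<Rightarrow> 'a" +
  fixes \<Omega> :: "'a set \<Rightarrow> real"
  assumes nonneg: "bounded A \<Longrightarrow> 0 \<le> \<Omega> A"
    and eq_0_iff: "bounded A \<Longrightarrow> \<Omega> A = 0 \<longleftrightarrow> compact (closure A)"
    and mono: "bounded A \<Longrightarrow> bounded B \<Longrightarrow> A \<subseteq> B \<Longrightarrow> \<Omega> A \<le> \<Omega> B"
    and closure: "bounded A \<Longrightarrow> \<Omega> (closure A) = \<Omega> A"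
    and scale: "bounded A \<Longrightarrow> \<Omega> (scale c ` A) = norm c * \<Omega> A"
    and finite_Un: "finite A \<Longrightarrow> bounded B \<Longrightarrow> A \<inter> B = {} \<Longrightarrow> \<Omega> (A \<union> B) = \<Omega> B"

text \<open>Meaningful for nonempty bounded sets, where both suprema are finite.\<close>

definition hausdorff_dist :: "'a::metric_space set \<Rightarrow> 'a set \<Rightarrow> real" where
  "hausdorff_dist A B = max (SUP a\<in>A. infdist a B) (SUP b\<in>B. infdist b A)"

definition nonconvexity :: "'a::real_normed_vector set \<Rightarrow> real" where
  "nonconvexity A = (if A = {} then 0 else hausdorff_dist A (convex hull A))"

definition comparison_function :: "(real \<Rightarrow> real) \<Rightarrow> bool" where
  "comparison_function \<phi> \<longleftrightarrow>
     \<phi> ` {0..} \<subseteq> {0..} \<and> mono_on {0..} \<phi> \<and> (\<forall>t\<ge>0. (\<lambda>n. (\<phi> ^^ n) t) \<longlonglongrightarrow> 0)"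

end

theory Submission
  imports Defs
begin

text \<open>
  The sets \<open>D n = \<Phi>\<^sup>n(C)\<close> decrease, and their noncompactness and nonconvexity tend to 0. Hence
  the intersection of their closures is nonempty and compact (a sequence with \<open>x n \<in> D n\<close> is
  relatively compact, since \<open>\<Omega>\<close> ignores finitely many terms), convex (a point of the convex hull has
  distance at most \<open>\<kappa> (D n)\<close> from \<open>D n\<close>) and invariant under \<open>\<Phi>\<close>, so Schauder's theorem applies.
  In Schauder's theorem the dimension of the approximating simplex varies, which rules out Brouwer's
  theorem for \<open>euclidean_space\<close>; Kuhn's combinatorial lemma on \<open>nat \<Rightarrow> nat\<close> yields the approximate
  fixed points instead.
\<close>

section \<open>Approximate fixed points on the cube\<close>

text \<open>Grid points are labelled by the direction in which \<open>f\<close> moves each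
  coordinate. Kuhn's lemma finds one cell in which every coordinate carries both labels, so each
  \<open>f x i - x i\<close> changes sign there up to a small error. Points are functions on all of
  \<open>nat\<close>; \<open>unif\<close> measures distance in the coordinates below
  \<open>n\<close> only and so also makes these coordinates of \<open>f x\<close> depend on those of
  \<open>x\<close> alone.\<close>

lemma approximate_fixed_point_cube:
  fixes f :: "(nat \<Rightarrow> real) \<Rightarrow> nat \<Rightarrow> real" and n :: nat
  assumes range: "\<And>x. x \<in> {..<n} \<rightarrow> {0..1} \<Longrightarrow> f x \<in> {..<n} \<rightarrow> {0..1}"
    and unif: "\<And>e. e > 0 \<Longrightarrow> \<exists>d>0. \<forall>x \<in> {..<n} \<rightarrow> {0..1}. \<forall>y \<in> {..<n} \<rightarrow> {0..1}.
                 (\<forall>i<n. \<bar>x i - y i\<bar> < d) \<longrightarrow> (\<forall>i<n. \<bar>f x i - f y i\<bar> < e)"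
    and e: "e > 0"
  obtains x where "x \<in> {..<n} \<rightarrow> {0..1}" "\<And>i. i < n \<Longrightarrow> \<bar>f x i - x i\<bar> < e"
proof -
  obtain d where d: "d > 0" and close: "\<And>x y i. x \<in> {..<n} \<rightarrow> {0..1} \<Longrightarrow> y \<in> {..<n} \<rightarrow> {0..1} \<Longrightarrow>
      (\<And>i. i < n \<Longrightarrow> \<bar>x i - y i\<bar> < d) \<Longrightarrow> i < n \<Longrightarrow> \<bar>f x i - f y i\<bar> < e / 2"
    using unif[OF half_gt_zero[OF e]] by blast
  \<comment> \<open>The mesh \<open>1 / p\<close> is below \<open>d\<close>, so that
    \<open>f\<close> varies by less than \<open>e / 2\<close> over a cell, and below
    \<open>e / 2\<close>, so that the width of the cell itself uses up only the other half of
    \<open>e\<close>.\<close>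
  obtain p :: nat where p: "0 < p" "1 / real p < min d (e / 2)"
    using reals_Archimedean[of "min d (e / 2)"] d e
    by (metis half_gt_zero inverse_eq_divide min_less_iff_conj zero_less_Suc)
  define g :: "(nat \<Rightarrow> nat) \<Rightarrow> nat \<Rightarrow> real" where "g q j = real (q j) / real p" for q j
  \<comment> \<open>Label 0 means that coordinate \<open>i\<close> does not decrease. The test
    \<open>q i < p\<close> forces label 1 on the upper face, as Kuhn's lemma demands; on the lower
    face label 0 is automatic because \<open>f\<close> is nonnegative.\<close>
  define label :: "(nat \<Rightarrow> nat) \<Rightarrow> nat \<Rightarrow> nat"
    where "label q i = (if q i < p \<and> g q i \<le> f (g q) i then 0 else 1)" for q i
  have gcube: "g q \<in> {..<n} \<rightarrow> {0..1}" if "\<forall>i<n. q i \<le> p" for q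
    using that p(1) by (auto simp: g_def)
  have fcube: "0 \<le> f (g q) i" "f (g q) i \<le> 1" if "\<forall>i<n. q i \<le> p" "i < n" for q i
    using range[OF gcube[OF that(1)]] that(2) by (auto simp: Pi_iff)
  have "\<forall>x. (\<forall>i<n. x i \<le> p) \<longrightarrow> (\<forall>i<n. label x i = 0 \<or> label x i = 1)"
    by (auto simp: label_def)
  moreover have "\<forall>x. (\<forall>i<n. x i \<le> p) \<longrightarrow> (\<forall>i<n. x i = 0 \<longrightarrow> label x i = 0)"
    using p(1) fcube by (auto simp: label_def g_def[of _ i for i])
  moreover have "\<forall>x. (\<forall>i<n. x i \<le> p) \<longrightarrow> (\<forall>i<n. x i = p \<longrightarrow> label x i = 1)"
    by (auto simp: label_def)
  ultimately obtain q where q: "\<forall>i<n. q i < p"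
    and rs: "\<forall>i<n. \<exists>r s. (\<forall>j<n. q j \<le> r j \<and> r j \<le> q j + 1) \<and>
               (\<forall>j<n. q j \<le> s j \<and> s j \<le> q j + 1) \<and> label r i \<noteq> label s i"
    by (rule kuhn_lemma[OF p(1)])
  have qp: "\<forall>i<n. q i \<le> p"
    using q by (auto intro: less_imp_le)
  have near: "g q j \<le> g r j" "g r j \<le> g q j + 1 / real p" "\<bar>f (g r) j - f (g q) j\<bar> < e / 2"
    and rp: "\<forall>j<n. r j \<le> p"
    if r: "\<forall>j<n. q j \<le> r j \<and> r j \<le> q j + 1" and j: "j < n" for r j
  proof -
    show rp: "\<forall>j<n. r j \<le> p"
    proof (intro allI impI)
      fix i assume "i < n"
      then have "r i \<le> q i + 1" "q i < p" using r q by blast+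
      then show "r i \<le> p" by linarith
    qed
    have *: "g q j \<le> g r j \<and> g r j \<le> g q j + 1 / real p" if "j < n" for j
    proof -
      have "r j \<le> q j + 1" using r that by blast
      then have "real (r j) \<le> real (q j) + 1" by linarith
      then have "real (r j) / real p \<le> (real (q j) + 1) / real p"
        by (rule divide_right_mono) simp
      then show ?thesis
        using r that by (auto simp: g_def divide_right_mono add_divide_distrib)
    qed
    then show "g q j \<le> g r j" "g r j \<le> g q j + 1 / real p"
      using j by auto
    show "\<bar>f (g r) j - f (g q) j\<bar> < e / 2"
    proof (rule close[OF gcube[OF rp] gcube[OF qp] _ j])
      show "\<bar>g r i - g q i\<bar> < d" if "i < n" for i
        using *[OF that] p(2) by auto
    qed
  qed
  show thesis
  proof (rule that[OF gcube[OF qp]])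
    fix i assume i: "i < n"
    have key: "\<bar>f (g q) i - g q i\<bar> < e"
      if r: "\<forall>j<n. q j \<le> r j \<and> r j \<le> q j + 1" and s: "\<forall>j<n. q j \<le> s j \<and> s j \<le> q j + 1"
        and l: "label r i = 0" "label s i \<noteq> 0" for r s
    proof -
      have "g r i \<le> f (g r) i"
        using l(1) by (auto simp: label_def split: if_splits)
      moreover have "f (g s) i \<le> g s i"
      proof (cases "s i < p")
        case True
        then show ?thesis using l(2) by (auto simp: label_def split: if_splits)
      next
        case False
        \<comment> \<open>On the upper face label 1 was imposed, but the inequality still holds
          there: \<open>g s i = 1\<close> bounds every value of \<open>f\<close>.\<close>
        then have "s i = p" using rp[OF s i] i by force
        then show ?thesis using fcube(2)[OF rp[OF s i] i] p(1) by (simp add: g_def[of s i])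
      qed
      ultimately show ?thesis
        using near[OF r i] near[OF s i] p(2) by (auto simp: abs_if split: if_splits)
    qed
    obtain r s where r: "\<forall>j<n. q j \<le> r j \<and> r j \<le> q j + 1"
      and s: "\<forall>j<n. q j \<le> s j \<and> s j \<le> q j + 1" and "label r i \<noteq> label s i"
      using rs i by blast
    then consider "label r i = 0" "label s i \<noteq> 0" | "label s i = 0" "label r i \<noteq> 0"
      by (auto simp: label_def split: if_splits)
    then show "\<bar>f (g q) i - g q i\<bar> < e"
      using key r s by cases blast+
  qed
qed

section \<open>Retraction onto the standard simplex\<close>

text \<open>
  A Lipschitz retraction of the positive orthant onto the standard simplex: the missing mass is
  assigned to coordinate 0, excess mass is scaled away.
\<close>

definition simplex_retraction :: "nat \<Rightarrow> (nat \<Rightarrow> real) \<Rightarrow> nat \<Rightarrow> real" where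
  "simplex_retraction n t i =
     (t i + (if i = 0 then max 0 (1 - sum t {..<n}) else 0)) / max 1 (sum t {..<n})"

lemma simplex_retraction_nonneg: "0 \<le> t i \<Longrightarrow> 0 \<le> simplex_retraction n t i"
  by (auto simp: simplex_retraction_def)

lemma sum_simplex_retraction:
  assumes "0 < n"
  shows "sum (simplex_retraction n t) {..<n} = 1"
proof -
  have "sum (simplex_retraction n t) {..<n} =
      (sum t {..<n} + (\<Sum>i<n. if i = 0 then max 0 (1 - sum t {..<n}) else 0)) / max 1 (sum t {..<n})"
    by (simp add: simplex_retraction_def sum_divide_distrib[symmetric] sum.distrib)
  also have "\<dots> = (sum t {..<n} + max 0 (1 - sum t {..<n})) / max 1 (sum t {..<n})"
    using assms by simp
  also have "\<dots> = 1"
    by (auto simp: max_def)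
  finally show ?thesis .
qed

lemma simplex_retraction_id: "sum t {..<n} = 1 \<Longrightarrow> simplex_retraction n t i = t i"
  by (simp add: simplex_retraction_def)

text \<open>The total masses differ by at most \<open>n * d\<close>. This difference enters once
  through the numerator, in addition to \<open>d\<close>, and once through the denominator, whence
  the factor \<open>2 * n + 1\<close>.\<close>

lemma simplex_retraction_lipschitz:
  assumes s: "\<And>j. j < n \<Longrightarrow> 0 \<le> s j" and close: "\<And>j. j < n \<Longrightarrow> \<bar>t j - s j\<bar> \<le> d" and i: "i < n"
  shows "\<bar>simplex_retraction n t i - simplex_retraction n s i\<bar> \<le> (2 * real n + 1) * d"
proof -
  define T S where "T = sum t {..<n}" and "S = sum s {..<n}"
  define a b where "a = t i + (if i = 0 then max 0 (1 - T) else 0)"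
    and "b = s i + (if i = 0 then max 0 (1 - S) else 0)"
  have "\<bar>T - S\<bar> \<le> (\<Sum>j<n. \<bar>t j - s j\<bar>)"
    unfolding T_def S_def by (simp add: sum_subtractf[symmetric] sum_abs)
  also have "\<dots> \<le> (\<Sum>j<n. d)"
    by (intro sum_mono close) simp
  finally have TS: "\<bar>T - S\<bar> \<le> real n * d" by simp
  have ab: "\<bar>a - b\<bar> \<le> d + \<bar>T - S\<bar>"
    using close[OF i] by (auto simp: a_def b_def)
  have M: "\<bar>max 1 S - max 1 T\<bar> \<le> \<bar>T - S\<bar>" by auto
  have "s i \<le> S"
    unfolding S_def by (rule member_le_sum) (use s i in auto)
  then have b: "0 \<le> b" "b \<le> max 1 S"
    using s i member_le_sum[of i "{..<n}" s] by (auto simp: b_def)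
  \<comment> \<open>The quotients are split so that the change of denominator is multiplied by
    \<open>b / max 1 S\<close>, which lies between 0 and 1.\<close>
  have "a / max 1 T - b / max 1 S = (a - b) / max 1 T + (b / max 1 S) * ((max 1 S - max 1 T) / max 1 T)"
    by (simp add: field_simps max_def)
  also have "\<bar>\<dots>\<bar> \<le> \<bar>a - b\<bar> / max 1 T + (b / max 1 S) * (\<bar>max 1 S - max 1 T\<bar> / max 1 T)"
    using b by (intro order_trans[OF abs_triangle_ineq]) (simp add: abs_mult)
  also have "\<dots> \<le> \<bar>a - b\<bar> + 1 * \<bar>max 1 S - max 1 T\<bar>"
  proof (intro add_mono mult_mono)
    have *: "x / max 1 T \<le> x" if "0 \<le> x" for x
      using that by (simp add: divide_le_eq mult_le_cancel_left1)
    show "\<bar>a - b\<bar> / max 1 T \<le> \<bar>a - b\<bar>" "\<bar>max 1 S - max 1 T\<bar> / max 1 T \<le> \<bar>max 1 S - max 1 T\<bar>"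
      by (rule *; simp)+
    show "b / max 1 S \<le> 1" using b by (simp add: divide_le_eq)
  qed auto
  finally show ?thesis
    using ab M TS unfolding simplex_retraction_def a_def b_def T_def S_def
    by (simp add: algebra_simps)
qed

section \<open>Schauder's fixed point theorem\<close>

text \<open>A partition of unity \<open>u\<close> on a finite \<open>e\<close>-net sends
  \<open>K\<close> to barycentric coordinates, and \<open>X\<close> sends the cube back into
  \<open>K\<close>. For an approximate fixed point \<open>t\<close> of \<open>u o f o X\<close>, the
  point \<open>X (u (f (X t)))\<close> is within \<open>e\<close> both of \<open>f (X t)\<close> and
  of \<open>X t\<close>.\<close>

lemma schauder_approximate:
  fixes K :: "'a::real_normed_vector set"
  assumes K: "compact K" "convex K" "K \<noteq> {}" and f: "continuous_on K f" "f ` K \<subseteq> K" and e: "e > 0"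
  obtains x where "x \<in> K" "dist (f x) x < 2 * e"
proof -
  obtain k where k: "finite k" "k \<subseteq> K" "K \<subseteq> (\<Union>x\<in>k. ball x e)"
    using compactE_image[OF K(1), of K "\<lambda>x. ball x e"] e by (metis UN_I centre_in_ball open_ball subsetI)
  obtain n p where kp: "k = p ` {..<n::nat}"
    using finite_imp_nat_seg_image_inj_on[OF k(1)] by (auto simp: lessThan_def)
  have n: "0 < n" using k(3) K(3) kp by (cases n) auto
  have pK: "p i \<in> K" if "i < n" for i using k(2) kp that by auto
  \<comment> \<open>A tent function, positive exactly on the open ball of radius \<open>e\<close>
    about \<open>p i\<close>.\<close>
  define w where "w i y = max 0 (e - dist y (p i))" for i y
  define W where "W y = (\<Sum>i<n. w i y)" for y
  define u where "u y i = w i y / W y" for i y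
  have w0: "0 \<le> w i y" for i y by (simp add: w_def)
  have W0: "0 < W y" if y: "y \<in> K" for y
  proof -
    obtain i where "i < n" "dist y (p i) < e"
      using k(3) y kp by (fastforce simp: dist_commute)
    then have "0 < w i y" by (simp add: w_def)
    with \<open>i < n\<close> show ?thesis unfolding W_def by (intro sum_pos2[of _ i]) (auto simp: w0)
  qed
  have usum: "sum (u y) {..<n} = 1" if "y \<in> K" for y
    using W0[OF that] by (simp add: u_def W_def sum_divide_distrib[symmetric])
  have u0: "0 \<le> u y i" if "y \<in> K" for y i
    using W0[OF that] w0 by (simp add: u_def)
  have u1: "u y i \<le> 1" if "y \<in> K" "i < n" for y i
    using member_le_sum[of i "{..<n}" "u y"] usum[OF that(1)] u0[OF that(1)] that(2) by auto
  have ucont: "continuous_on K (\<lambda>y. u y i)" for i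
    unfolding u_def W_def w_def
    by (intro continuous_intros) (use W0 in \<open>force simp: W_def w_def\<close>)
  \<comment> \<open>The retraction extends the barycentric map from the simplex to the whole cube,
    the domain that the combinatorial lemma handles.\<close>
  define X where "X t = (\<Sum>i<n. simplex_retraction n t i *\<^sub>R p i)" for t
  have XK: "X t \<in> K" if "t \<in> {..<n} \<rightarrow> {0..1}" for t
    unfolding X_def using sum_simplex_retraction[OF n] that
    by (intro convex_sum K pK) (auto intro!: simplex_retraction_nonneg)
  have Xu: "dist (X (u y)) y < e" if y: "y \<in> K" for y
  proof -
    have "X (u y) - y = (\<Sum>i<n. u y i *\<^sub>R (p i - y))"
      using usum[OF y]
      by (simp add: X_def simplex_retraction_id scaleR_diff_right sum_subtractf flip: scaleR_sum_left)
    also have "norm \<dots> \<le> (\<Sum>i<n. u y i * norm (p i - y))"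
      using u0[OF y] by (intro order_trans[OF norm_sum]) simp
    \<comment> \<open>Strictness: the weights sum to 1, so some weight is nonzero, and a nonzero
      weight occurs only where \<open>p i\<close> is closer than \<open>e\<close>.\<close>
    also have "\<dots> < (\<Sum>i<n. u y i * e)"
    proof (rule sum_strict_mono_ex1)
      have *: "u y i = 0 \<or> norm (p i - y) < e" for i
        by (auto simp: u_def w_def dist_norm norm_minus_commute)
      then show "\<forall>i\<in>{..<n}. u y i * norm (p i - y) \<le> u y i * e"
        using u0[OF y] by (metis less_eq_real_def mult_left_mono mult_zero_left)
      obtain i where "i < n" "u y i \<noteq> 0"
        using usum[OF y] by (metis lessThan_iff sum.neutral zero_neq_one)
      with * u0[OF y, of i] show "\<exists>i\<in>{..<n}. u y i * norm (p i - y) < u y i * e"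
        by (intro bexI[of _ i]) (auto intro!: mult_strict_left_mono)
    qed simp
    also have "\<dots> = e" using usum[OF y] by (simp flip: sum_distrib_right)
    finally show ?thesis by (simp add: dist_norm)
  qed
  obtain B where B: "0 < B" "\<And>x. x \<in> K \<Longrightarrow> norm x \<le> B"
    using compact_imp_bounded[OF K(1)] by (auto simp: bounded_pos)
  \<comment> \<open>A Lipschitz constant of \<open>X\<close> for the maximum distance of
    coordinates: \<open>n\<close> summands, each the Lipschitz constant of the retraction times the
    norm bound \<open>B\<close>.\<close>
  define L where "L = real n * ((2 * real n + 1) * B)"
  have L: "0 < L" using n B by (simp add: L_def)
  have Xlip: "dist (X t) (X s) \<le> L * d"
    if "s \<in> {..<n} \<rightarrow> {0..1}" "\<And>j. j < n \<Longrightarrow> \<bar>t j - s j\<bar> \<le> d" for s t d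
  proof -
    have "0 \<le> d" using that(2)[OF n] by linarith
    have "dist (X t) (X s) \<le> (\<Sum>i<n. \<bar>simplex_retraction n t i - simplex_retraction n s i\<bar> * norm (p i))"
      unfolding dist_norm X_def sum_subtractf[symmetric] scaleR_diff_left[symmetric]
      by (rule order_trans[OF norm_sum]) simp
    also have "\<dots> \<le> (\<Sum>i<n. ((2 * real n + 1) * d) * B)"
      using that B(1) \<open>0 \<le> d\<close>
      by (intro sum_mono mult_mono simplex_retraction_lipschitz B pK) (auto simp: Pi_iff)
    finally show ?thesis by (simp add: L_def algebra_simps)
  qed
  have "\<exists>t \<in> {..<n} \<rightarrow> {0..1}. \<forall>i<n. \<bar>u (f (X t)) i - t i\<bar> < e / L"
  proof (rule approximate_fixed_point_cube[of n "\<lambda>t. u (f (X t))" "e / L"])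
    show "u (f (X t)) \<in> {..<n} \<rightarrow> {0..1}" if "t \<in> {..<n} \<rightarrow> {0..1}" for t
    proof -
      have "f (X t) \<in> K" using XK[OF that] f(2) by auto
      then show ?thesis using u0 u1 by auto
    qed
  next
    fix r :: real assume r: "r > 0"
    have "\<exists>d>0. \<forall>x\<in>K. \<forall>x'\<in>K. dist x' x < d \<longrightarrow> \<bar>u (f x') i - u (f x) i\<bar> < r" for i
    proof -
      have "continuous_on K (\<lambda>x. u (f x) i)"
        using continuous_on_compose2[OF ucont f(1) f(2)] .
      then have "uniformly_continuous_on K (\<lambda>x. u (f x) i)"
        using compact_uniformly_continuous K(1) by blast
      then show ?thesis
        using r unfolding uniformly_continuous_on_def dist_real_def by blast
    qed
    then obtain d where d: "\<And>i. d i > 0" "\<And>i x x'. x \<in> K \<Longrightarrow> x' \<in> K \<Longrightarrow> dist x' x < d i \<Longrightarrow>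
        \<bar>u (f x') i - u (f x) i\<bar> < r"
      by metis
    define D where "D = Min (d ` {..<n})"
    have D: "0 < D" "\<And>i. i < n \<Longrightarrow> D \<le> d i"
      using d(1) n unfolding D_def by (subst Min_gr_iff) auto
    show "\<exists>d>0. \<forall>x\<in>{..<n} \<rightarrow> {0..1}. \<forall>y\<in>{..<n} \<rightarrow> {0..1}.
        (\<forall>i<n. \<bar>x i - y i\<bar> < d) \<longrightarrow> (\<forall>i<n. \<bar>u (f (X x)) i - u (f (X y)) i\<bar> < r)"
    \<comment> \<open>The bound from \<open>Xlip\<close> is not strict; the factor 2 brings the
      distance strictly below every \<open>d i\<close>.\<close>
    proof (intro exI[of _ "D / (2 * L)"] conjI ballI impI allI)
      fix x y :: "nat \<Rightarrow> real" and i
      assume xy: "x \<in> {..<n} \<rightarrow> {0..1}" "y \<in> {..<n} \<rightarrow> {0..1}"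
        and le: "\<forall>i<n. \<bar>x i - y i\<bar> < D / (2 * L)" and i: "i < n"
      have "dist (X x) (X y) \<le> L * (D / (2 * L))"
        using le by (intro Xlip xy) (auto intro: less_imp_le)
      also have "\<dots> < d i" using L D(1) D(2)[OF i] by simp
      finally show "\<bar>u (f (X x)) i - u (f (X y)) i\<bar> < r"
        by (intro d(2) XK xy)
    qed (use D L in simp)
  qed (use e L in auto)
  then obtain t where t: "t \<in> {..<n} \<rightarrow> {0..1}" "\<And>i. i < n \<Longrightarrow> \<bar>u (f (X t)) i - t i\<bar> < e / L"
    by blast
  have fX: "f (X t) \<in> K" using XK[OF t(1)] f(2) by auto
  have "dist (X (u (f (X t)))) (X t) \<le> L * (e / L)"
    using t by (intro Xlip) (auto intro: less_imp_le)
  then have "dist (f (X t)) (X t) < 2 * e"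
    using Xu[OF fX] L dist_triangle2[of "f (X t)" "X t" "X (u (f (X t)))"]
    by (simp add: dist_commute)
  with XK[OF t(1)] that show thesis by blast
qed

text \<open>By compactness the displacement attains its minimum; a positive minimum would contradict
  the approximate version with half of it as \<open>e\<close>.\<close>

theorem schauder:
  fixes K :: "'a::real_normed_vector set"
  assumes K: "compact K" "convex K" "K \<noteq> {}" and f: "continuous_on K f" "f ` K \<subseteq> K"
  shows "\<exists>x\<in>K. f x = x"
proof -
  have "\<exists>x\<in>K. \<forall>y\<in>K. dist (f x) x \<le> dist (f y) y"
    by (rule continuous_attains_inf[OF K(1,3) continuous_on_dist[OF f(1) continuous_on_id]])
  then obtain x where x: "x \<in> K" "\<And>y. y \<in> K \<Longrightarrow> dist (f x) x \<le> dist (f y) y"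
    by blast
  have "dist (f x) x \<le> 0"
  proof (rule ccontr)
    assume "\<not> dist (f x) x \<le> 0"
    then have "0 < dist (f x) x / 2" by simp
    then obtain y where "y \<in> K" "dist (f y) y < 2 * (dist (f x) x / 2)"
      by (rule schauder_approximate[OF K f])
    with x(2)[of y] show False by simp
  qed
  with x(1) show ?thesis by auto
qed

section \<open>Decreasing sequences of sets\<close>

text \<open>Boundedness makes the real \<open>SUP\<close> in the Hausdorff distance a genuine upper
  bound on the convex hull. The estimate passes to the closure because \<open>infdist\<close> is
  continuous.\<close>

lemma infdist_le_nonconvexity:
  assumes A: "bounded A" "A \<noteq> {}" and z: "z \<in> closure (convex hull A)"
  shows "infdist z A \<le> nonconvexity A"
proof -
  obtain a where a: "a \<in> A" using A by auto
  obtain e where e: "\<And>y. y \<in> convex hull A \<Longrightarrow> dist a y \<le> e"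
    using bounded_convex_hull[OF A(1)] unfolding bounded_any_center[where a = a] by blast
  have "bdd_above ((\<lambda>y. infdist y A) ` (convex hull A))"
    using infdist_le[OF a] e by (force intro!: bdd_aboveI2[of _ _ e] simp: dist_commute intro: order_trans)
  then have "infdist y A \<le> nonconvexity A" if "y \<in> convex hull A" for y
    using cSUP_upper[OF that, of "\<lambda>y. infdist y A"] A(2)
    by (simp add: nonconvexity_def hausdorff_dist_def le_max_iff_disj)
  then have "convex hull A \<subseteq> {y. infdist y A \<le> nonconvexity A}" by auto
  moreover have "closed {y. infdist y A \<le> nonconvexity A}"
    by (intro closed_Collect_le continuous_intros)
  ultimately show ?thesis
    using z closure_minimal by blast
qed

lemma nonconvexity_nonneg:
  assumes "bounded A"
  shows "0 \<le> nonconvexity A"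
proof (cases "A = {}")
  case False
  then obtain a where "a \<in> closure (convex hull A)"
    by (metis closure_eq_empty convex_hull_eq_empty ex_in_conv)
  then show ?thesis
    using infdist_le_nonconvexity[OF assms False] infdist_nonneg order_trans by blast
qed (simp add: nonconvexity_def)

text \<open>Monotonicity of the comparison function turns the recursive inequality into
  \<open>a n \<le> (\<phi> ^^ n) (a 0)\<close>.\<close>

lemma comparison_function_iterate_tendsto_0:
  fixes a :: "nat \<Rightarrow> real"
  assumes \<phi>: "comparison_function \<phi>" and a0: "\<And>n. 0 \<le> a n" and step: "\<And>n. a (Suc n) \<le> \<phi> (a n)"
  shows "a \<longlonglongrightarrow> 0"
proof -
  have le: "a n \<le> (\<phi> ^^ n) (a 0)" for n
  proof (induction n)
    case (Suc n)
    have "a (Suc n) \<le> \<phi> (a n)" by (rule step)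
    also have "\<dots> \<le> \<phi> ((\<phi> ^^ n) (a 0))"
      using \<phi> Suc a0[of n] by (auto simp: comparison_function_def intro: mono_onD)
    finally show ?case by simp
  qed simp
  have "(\<lambda>n. (\<phi> ^^ n) (a 0)) \<longlonglongrightarrow> 0"
    using \<phi> a0 by (simp add: comparison_function_def)
  then show ?thesis
    by (rule tendsto_sandwich[OF _ _ tendsto_const, rotated 2]) (use a0 le in auto)
qed

text \<open>Kuratowski's analogue of Cantor's intersection theorem: a bounded set whose
  \<open>\<Omega>\<close> is at most every \<open>\<Omega> (D n)\<close> is relatively compact. This
  serves both the intersection and the range of a selected sequence.\<close>

lemma (in quasimeasure_of_noncompactness) decseq_Inter_closure:
  assumes D: "decseq D" and b: "bounded (D 0)" and ne: "\<And>n. D n \<noteq> {}"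
    and lim: "(\<lambda>n. \<Omega> (D n)) \<longlonglongrightarrow> 0"
  shows "compact (\<Inter>n. closure (D n))" "(\<Inter>n. closure (D n)) \<noteq> {}"
proof -
  have bD: "bounded (D n)" for n
    using b D bounded_subset by (metis decseq_def zero_le)
  have zero: "compact (closure A)"
    if A: "bounded A" and le: "\<And>n. \<Omega> A \<le> \<Omega> (D n)" for A
  proof -
    have "\<Omega> A \<le> 0" using le by (intro LIMSEQ_le_const[OF lim]) auto
    then show ?thesis using nonneg[OF A] eq_0_iff[OF A] by simp
  qed
  let ?K = "\<Inter>n. closure (D n)"
  have bK: "bounded ?K"
    by (rule bounded_subset[OF bounded_closure[OF bD[of 0]]]) auto
  have "compact (closure ?K)"
  proof (rule zero[OF bK])
    fix n
    show "\<Omega> ?K \<le> \<Omega> (D n)"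
      using mono[OF bK bounded_closure[OF bD[of n]]] closure[OF bD[of n]] by auto
  qed
  then show "compact ?K" by (simp add: closed_INT)
  have "\<forall>n. \<exists>y. y \<in> D n" using ne by blast
  then obtain x where x: "\<And>n. x n \<in> D n" by metis
  have xD: "x m \<in> D n" if "n \<le> m" for m n
    using x[of m] D that by (auto simp: decseq_def)
  have rx: "bounded (range x)"
    by (rule bounded_subset[OF bD[of 0]]) (use xD in auto)
  have "compact (closure (range x))"
  proof (rule zero[OF rx])
    fix n
    let ?B = "x ` {n..}"
    have B: "?B \<subseteq> D n" using xD by auto
    have bB: "bounded ?B" by (rule bounded_subset[OF bD B])
    \<comment> \<open>The tail is removed from the finite initial part because
      \<open>finite_Un\<close> asks for disjoint sets.\<close>
    have "range x = (x ` {..<n} - ?B) \<union> ?B" by (force simp: not_less)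
    then have "\<Omega> (range x) = \<Omega> ?B"
      using finite_Un[of "x ` {..<n} - ?B" ?B] bB by auto
    also have "\<dots> \<le> \<Omega> (D n)" by (rule mono[OF bB bD B])
    finally show "\<Omega> (range x) \<le> \<Omega> (D n)" .
  qed
  then obtain l r where l: "strict_mono r" "(x \<circ> r) \<longlonglongrightarrow> l"
    unfolding compact_def using closure_subset[of "range x"] by (metis UNIV_I image_subset_iff)
  \<comment> \<open>Since \<open>r i \<ge> i\<close>, the subsequence shifted by \<open>n\<close>
    stays in \<open>D n\<close>.\<close>
  have "l \<in> closure (D n)" for n
    unfolding closure_sequential
    using xD seq_suble[OF l(1)] LIMSEQ_ignore_initial_segment[OF l(2), of n]
    by (intro exI[of _ "\<lambda>i. (x \<circ> r) (i + n)"]) (auto intro: order_trans[OF le_add2])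
  then show "?K \<noteq> {}" by blast
qed

text \<open>For \<open>z\<close> in the hull of the intersection and fixed \<open>m\<close>, the
  distance to \<open>D m\<close> is at most that to the smaller \<open>D n\<close>, hence at most
  \<open>nonconvexity (D n)\<close>, which vanishes as \<open>n\<close> grows.\<close>

lemma convex_Inter_closure_nonconvexity:
  assumes D: "decseq D" and b: "\<And>n. bounded (D n)" and ne: "\<And>n. D n \<noteq> {}"
    and lim: "(\<lambda>n. nonconvexity (D n)) \<longlonglongrightarrow> 0"
  shows "convex (\<Inter>n. closure (D n))"
proof -
  let ?K = "\<Inter>n. closure (D n)"
  have "convex hull ?K \<subseteq> ?K"
  proof (intro subsetI INT_I)
    fix z m assume z: "z \<in> convex hull ?K"
    have "infdist z (D m) \<le> 0"
    proof (rule LIMSEQ_le_const[OF lim], intro exI allI impI)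
      fix n assume n: "m \<le> n"
      have "?K \<subseteq> closure (convex hull D n)"
        using closure_mono[OF hull_subset[of "D n" convex]] by auto
      then have "convex hull ?K \<subseteq> closure (convex hull D n)"
        by (intro hull_minimal convex_closure convex_convex_hull)
      then have "infdist z (D n) \<le> nonconvexity (D n)"
        using z infdist_le_nonconvexity[OF b ne] by blast
      moreover have "infdist z (D m) \<le> infdist z (D n)"
        using D n ne by (intro infdist_mono) (auto simp: decseq_def)
      ultimately show "infdist z (D m) \<le> nonconvexity (D n)" by simp
    qed
    then show "z \<in> closure (D m)"
      using in_closure_iff_infdist_zero[OF ne[of m]] infdist_nonneg[of z "D m"] by simp
  qed
  then show ?thesis
    by (metis convex_convex_hull hull_subset subset_antisym)
qed

section \<open>The invariant compact convex set and the fixed point\<close>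

theorem theorem6:
  fixes scale :: "'k::real_normed_field \<Rightarrow> 'a::banach \<Rightarrow> 'a"
    and \<Omega> :: "'a set \<Rightarrow> real"
    and C :: "'a set"
    and \<Phi> :: "'a \<Rightarrow> 'a"
    and \<phi>\<^sub>D \<phi>\<^sub>E :: "real \<Rightarrow> real"
  assumes "quasimeasure_of_noncompactness scale \<Omega>"
    and "C \<noteq> {}" and "bounded C" and "closed C"
    and "\<Phi> ` C \<subseteq> C" and "continuous_on C \<Phi>"
    and "comparison_function \<phi>\<^sub>D"
    and "\<And>A. A \<subseteq> C \<Longrightarrow> \<Omega> (\<Phi> ` A) \<le> \<phi>\<^sub>D (\<Omega> A)"
    and "comparison_function \<phi>\<^sub>E"
    and "\<And>A. A \<subseteq> C \<Longrightarrow> nonconvexity (\<Phi> ` A) \<le> \<phi>\<^sub>E (nonconvexity A)"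
  shows "\<exists>x\<in>C. \<Phi> x = x"
proof -
  interpret quasimeasure_of_noncompactness scale \<Omega> by fact
  define D where "D n = ((`) \<Phi> ^^ n) C" for n
  have D_Suc: "D (Suc n) = \<Phi> ` D n" for n by (simp add: D_def)
  have "D (Suc n) \<subseteq> D n" for n
  proof (induction n)
    case 0
    show ?case using \<open>\<Phi> ` C \<subseteq> C\<close> by (simp add: D_def)
  next
    case (Suc n)
    then show ?case by (simp only: D_Suc image_mono)
  qed
  then have dec: "decseq D" by (rule decseq_SucI)
  have D0: "D 0 = C" by (simp add: D_def)
  have DC: "D n \<subseteq> C" for n
    using dec D0 by (metis decseq_def zero_le)
  have b: "bounded (D n)" for n
    using DC bounded_subset \<open>bounded C\<close> by blast
  have ne: "D n \<noteq> {}" for n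
    by (induction n) (use \<open>C \<noteq> {}\<close> in \<open>auto simp: D0 D_Suc\<close>)
  have "(\<lambda>n. \<Omega> (D n)) \<longlonglongrightarrow> 0"
    by (rule comparison_function_iterate_tendsto_0[OF \<open>comparison_function \<phi>\<^sub>D\<close>])
      (simp_all add: nonneg b D_Suc assms(8) DC)
  note K = decseq_Inter_closure[OF dec b ne this]
  have "(\<lambda>n. nonconvexity (D n)) \<longlonglongrightarrow> 0"
    by (rule comparison_function_iterate_tendsto_0[OF \<open>comparison_function \<phi>\<^sub>E\<close>])
      (simp_all add: nonconvexity_nonneg b D_Suc assms(10) DC)
  note convex = convex_Inter_closure_nonconvexity[OF dec b ne this]
  let ?K = "\<Inter>n. closure (D n)"
  have clC: "closure (D n) \<subseteq> C" for n
    using DC \<open>closed C\<close> closure_minimal by blast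
  then have KC: "?K \<subseteq> C" by blast
  \<comment> \<open>Closedness of \<open>C\<close> keeps these closures inside the domain of
    continuity. The shift from \<open>n\<close> to \<open>Suc n\<close> is harmless because the
    closures decrease.\<close>
  have "\<Phi> ` closure (D n) \<subseteq> closure (D (Suc n))" for n
    using continuous_on_subset[OF \<open>continuous_on C \<Phi>\<close> clC]
    by (rule image_closure_subset) (simp_all add: D_Suc closure_subset)
  moreover have "closure (D (Suc n)) \<subseteq> closure (D n)" for n
    using dec by (intro closure_mono) (simp add: decseq_Suc_iff)
  ultimately have "\<Phi> ` ?K \<subseteq> ?K" by fast
  then obtain x where "x \<in> ?K" "\<Phi> x = x"
    by (rule schauder[OF K(1) convex K(2) continuous_on_subset[OF \<open>continuous_on C \<Phi>\<close> KC], THEN bexE])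
  then show ?thesis
    using subsetD[OF KC] by (intro bexI)
qed

end
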